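(* Let $G$ be a $T_1$ left topological group, let $J$ be a left-invariant exhaustive ideal on $G$, let $C\in J$, and let $S$ be a subsemigroup of $G$ such that $S$ is not $J$-compact in $G$ and $|S|<\chi(J)$. Then there exists an open subset $P$ of $G$ such that $C\subseteq P$ and for every finite coloring of $S\setminus P$ there exists a family $\mathcal A$ of sequences in $S\setminus P$ which satisfies the following conditions: (i) each $A\in\mathcal A$ is closed and discrete in $G$; (ii) the set $\bigcup_{A\in\mathcal A}\operatorname{FS}(A)$ is monochromatic (in particular it is contained in $S\setminus P$); (iii) $\operatorname{FS}(A)\cap \operatorname{FS}(B)=\emptyset$ for all distinct $A,B\in\mathcal A$; (iv) $\bigcup_{A\in\mathcal A}\operatorname{FS}(A)\in J^+$. Moreover, $P$ and the families $\mathcal A$ can be chosen so that: (v) if $J$ is additionally nicely exhaustive with respect to $S$, then $\operatorname{FS}(A)$ is a closed discrete subset of $G$ for all $A\in\mathcal A$; (vi) if $J$ is not a near-maximal ideal, then $P\in J^+$.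
   Context: $\mathbb N$ is the set of positive integers. Sequences are injective, indexed by $\mathbb N$, and identified with their images. For a sequence $A=\{a(n):n\in\mathbb N\}$ in a semigroup, $\operatorname{FS}(A)=A\cup\{a(n_1)a(n_2)\cdots a(n_k): k\ge 2,\ n_1<n_2<\dots<n_k\}$. A finite coloring of a set is a map from it to a finite set; a subset is monochromatic if the coloring is defined and constant on it. A left topological group is a group with a topology such that every left shift $x\mapsto sx$ is continuous. A space is $T_1$ if all singletons are closed. $o(X)$ denotes the set of open subsets of $X$. An ideal on a set $X$ is a nonempty $J\subseteq\mathcal P(X)$ with $X\notin J$, closed under finite unions and under taking subsets; $J^+=\mathcal P(X)\setminus J$. Let $J$ be an ideal on a space $X$. - $Y\subseteq X$ is $J$-compact in $X$ if for each map $\phi:J\to o(X)$ with $A\subseteq\phi(A)$ for all $A\in J$ there is a finite $F\subseteq J$ with $Y\subseteq\bigcup_{A\in F}\phi(A)$. - $J$ is exhaustive if there is a family $\{A_i:i\in\mathbb N\}\subseteq J\cap o(X)$ with $\bigcup_{i}A_i=X$ and $A_i\subseteq A_{i+1}$ for all $i$. - $J$ is near-maximal if there is an ultrafilter $u$ on the set $X$ such that $\{X\setminus\overline U:U\in u\}\subseteq J$. - $\chi(J)$ is the minimal cardinal $\kappa$ such that: there exists $A\in J$ such that for each $B\in J$ with $A\subseteq B$ there exists a family $\{U_\alpha:\alpha\in\kappa\}$ of open sets containing $B$ such that for every open $W\supseteq B$ there is $\alpha\in\kappa$ with $W\setminus U_\alpha\notin J$. If no such cardinal exists, $\chi(J)=|X|^+$.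 An ideal $J$ on a semigroup $T$ is left-invariant if $xA\in J$ for all $A\in J$, $x\in T$. A subset $A$ of a semigroup $S$ is a left ideal if $SA\subseteq A$. For a subsemigroup $S$ of a left topological group $G$, an ideal $J$ on $G$ is nicely exhaustive with respect to $S$ if there is a family $\{A_i:i\in\mathbb N\}\subseteq J$ of open sets such that $\bigcup_iA_i=G$, $A_i\subseteq A_{i+1}$ for all $i$, and $S\setminus A_i$ is a nonempty left ideal in $S$ for each $i$. *)

theory Defs
  imports "HOL-Algebra.Coset" "HOL-Analysis.T1_Spaces"
begin

unbundle cardinal_syntax
no_notation eq_closure_of (\<open>closure'_of\<index>\<close>)

text \<open>
  A group is a \<^locale>\<open>group\<close> \<open>G\<close>, and a topology on it is an abstract topology \<open>X\<close> whose underlying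
  set is \<open>carrier G\<close>.
\<close>

definition left_topological_group :: "('a, 'b) monoid_scheme \<Rightarrow> 'a topology \<Rightarrow> bool" where
  "left_topological_group G X \<longleftrightarrow>
     group G \<and> topspace X = carrier G \<and>
     (\<forall>s \<in> carrier G. continuous_map X X (\<lambda>x. s \<otimes>\<^bsub>G\<^esub> x))"

definition subsemigroup :: "('a, 'b) monoid_scheme \<Rightarrow> 'a set \<Rightarrow> bool" where
  "subsemigroup G S \<longleftrightarrow> S \<subseteq> carrier G \<and> (\<forall>x \<in> S. \<forall>y \<in> S. x \<otimes>\<^bsub>G\<^esub> y \<in> S)"

definition left_ideal_in :: "('a, 'b) monoid_scheme \<Rightarrow> 'a set \<Rightarrow> 'a set \<Rightarrow> bool" where
  "left_ideal_in G S A \<longleftrightarrow> A \<subseteq> S \<and> S <#>\<^bsub>G\<^esub> A \<subseteq> A"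


subsection \<open>Ideals\<close>

definition set_ideal :: "'a set \<Rightarrow> 'a set set \<Rightarrow> bool" where
  "set_ideal X J \<longleftrightarrow>
     J \<noteq> {} \<and> J \<subseteq> Pow X \<and> X \<notin> J \<and>
     (\<forall>A \<in> J. \<forall>B \<in> J. A \<union> B \<in> J) \<and>
     (\<forall>A \<in> J. \<forall>B. B \<subseteq> A \<longrightarrow> B \<in> J)"

definition positive_sets :: "'a set \<Rightarrow> 'a set set \<Rightarrow> 'a set set" where
  "positive_sets X J = Pow X - J"

definition left_invariant :: "('a, 'b) monoid_scheme \<Rightarrow> 'a set set \<Rightarrow> bool" where
  "left_invariant G J \<longleftrightarrow> (\<forall>A \<in> J. \<forall>x \<in> carrier G. x <#\<^bsub>G\<^esub> A \<in> J)"

definition ideal_compact_in :: "'a topology \<Rightarrow> 'a set set \<Rightarrow> 'a set \<Rightarrow> bool" where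
  "ideal_compact_in X J Y \<longleftrightarrow>
     Y \<subseteq> topspace X \<and>
     (\<forall>\<phi> :: 'a set \<Rightarrow> 'a set. (\<forall>A \<in> J. openin X (\<phi> A) \<and> A \<subseteq> \<phi> A) \<longrightarrow>
        (\<exists>F. finite F \<and> F \<subseteq> J \<and> Y \<subseteq> (\<Union>A \<in> F. \<phi> A)))"

definition exhaustive :: "'a topology \<Rightarrow> 'a set set \<Rightarrow> bool" where
  "exhaustive X J \<longleftrightarrow>
     (\<exists>A :: nat \<Rightarrow> 'a set.
        (\<forall>i. A i \<in> J \<and> openin X (A i)) \<and>
        (\<Union>i. A i) = topspace X \<and> (\<forall>i. A i \<subseteq> A (Suc i)))"

definition nicely_exhaustive ::
    "('a, 'b) monoid_scheme \<Rightarrow> 'a topology \<Rightarrow> 'a set \<Rightarrow> 'a set set \<Rightarrow> bool" where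
  "nicely_exhaustive G X S J \<longleftrightarrow>
     (\<exists>A :: nat \<Rightarrow> 'a set.
        (\<forall>i. A i \<in> J \<and> openin X (A i)) \<and>
        (\<Union>i. A i) = carrier G \<and> (\<forall>i. A i \<subseteq> A (Suc i)) \<and>
        (\<forall>i. S - A i \<noteq> {} \<and> left_ideal_in G S (S - A i)))"

definition ultrafilter_on :: "'a set \<Rightarrow> 'a set set \<Rightarrow> bool" where
  "ultrafilter_on X u \<longleftrightarrow>
     u \<subseteq> Pow X \<and> X \<in> u \<and> {} \<notin> u \<and>
     (\<forall>A \<in> u. \<forall>B \<in> u. A \<inter> B \<in> u) \<and>
     (\<forall>A \<in> u. \<forall>B. A \<subseteq> B \<and> B \<subseteq> X \<longrightarrow> B \<in> u) \<and>
     (\<forall>A. A \<subseteq> X \<longrightarrow> A \<in> u \<or> X - A \<in> u)"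

definition near_maximal :: "'a topology \<Rightarrow> 'a set set \<Rightarrow> bool" where
  "near_maximal X J \<longleftrightarrow>
     (\<exists>u. ultrafilter_on (topspace X) u \<and> {topspace X - X closure_of U | U. U \<in> u} \<subseteq> J)"


subsection \<open>The cardinal \<open>\<chi>(J)\<close>\<close>

definition chi_family :: "'a topology \<Rightarrow> 'a set set \<Rightarrow> 'k set \<Rightarrow> bool" where
  "chi_family X J I \<longleftrightarrow>
     (\<exists>A \<in> J. \<forall>B \<in> J. A \<subseteq> B \<longrightarrow>
        (\<exists>U :: 'k \<Rightarrow> 'a set.
           (\<forall>\<alpha> \<in> I. openin X (U \<alpha>) \<and> B \<subseteq> U \<alpha>) \<and>
           (\<forall>W. openin X W \<and> B \<subseteq> W \<longrightarrow> (\<exists>\<alpha> \<in> I. W - U \<alpha> \<notin> J))))"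

text \<open>
  A cardinal is a cardinal well-order on a type and serves as the index set via its field.
  The candidates below are the cardinals on the type of sets of points; lemma \<open>chi_family_small\<close>
  shows that allowing larger index types would not change the minimum. The successor cardinal
  \<open>|X|\<^sup>+\<close> also lives on that type.
\<close>

definition is_chi :: "'a topology \<Rightarrow> 'a set set \<Rightarrow> 'a set rel \<Rightarrow> bool" where
  "is_chi X J \<kappa> \<longleftrightarrow>
     Card_order \<kappa> \<and> chi_family X J (Field \<kappa>) \<and>
     (\<forall>\<mu> :: 'a set rel. Card_order \<mu> \<and> chi_family X J (Field \<mu>) \<longrightarrow> \<kappa> \<le>o \<mu>)"

definition chi :: "'a topology \<Rightarrow> 'a set set \<Rightarrow> 'a set rel" where
  "chi X J =
     (if \<exists>\<kappa> :: 'a set rel. Card_order \<kappa> \<and> chi_family X J (Field \<kappa>)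
      then SOME \<kappa>. is_chi X J \<kappa>
      else cardSuc |topspace X| )"

lemma chi_family_mono:
  assumes "chi_family X J I"
    and step: "\<And>B U. (\<forall>\<alpha> \<in> I. openin X (U \<alpha>) \<and> B \<subseteq> U \<alpha>) \<Longrightarrow>
      \<exists>U'. (\<forall>\<beta> \<in> I'. openin X (U' \<beta>) \<and> B \<subseteq> U' \<beta>) \<and> (\<forall>\<alpha> \<in> I. \<exists>\<beta> \<in> I'. U' \<beta> = U \<alpha>)"
  shows "chi_family X J I'"
proof -
  from assms(1) obtain A where A: "A \<in> J" and *: "\<forall>B \<in> J. A \<subseteq> B \<longrightarrow>
      (\<exists>U. (\<forall>\<alpha> \<in> I. openin X (U \<alpha>) \<and> B \<subseteq> U \<alpha>) \<and>
         (\<forall>W. openin X W \<and> B \<subseteq> W \<longrightarrow> (\<exists>\<alpha> \<in> I. W - U \<alpha> \<notin> J)))"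
    unfolding chi_family_def by (rule bexE)
  show ?thesis
    unfolding chi_family_def
  proof (rule bexI[OF _ A], intro ballI impI)
    fix B assume "B \<in> J" "A \<subseteq> B"
    from *[rule_format, OF this] obtain U where U: "\<forall>\<alpha> \<in> I. openin X (U \<alpha>) \<and> B \<subseteq> U \<alpha>"
      and W: "\<forall>W. openin X W \<and> B \<subseteq> W \<longrightarrow> (\<exists>\<alpha> \<in> I. W - U \<alpha> \<notin> J)"
      by (elim exE conjE)
    from step[OF U] obtain U' where U': "\<forall>\<beta> \<in> I'. openin X (U' \<beta>) \<and> B \<subseteq> U' \<beta>"
      and eq: "\<forall>\<alpha> \<in> I. \<exists>\<beta> \<in> I'. U' \<beta> = U \<alpha>"
      by (elim exE conjE)
    have "\<forall>W. openin X W \<and> B \<subseteq> W \<longrightarrow> (\<exists>\<beta> \<in> I'. W - U' \<beta> \<notin> J)"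
      using W eq by metis
    with U' show "\<exists>U. (\<forall>\<alpha> \<in> I'. openin X (U \<alpha>) \<and> B \<subseteq> U \<alpha>) \<and>
         (\<forall>W. openin X W \<and> B \<subseteq> W \<longrightarrow> (\<exists>\<alpha> \<in> I'. W - U \<alpha> \<notin> J))"
      by (intro exI[of _ U'] conjI)
  qed
qed

lemma chi_family_small:
  fixes I :: "'k set" and J :: "'a set set"
  assumes "chi_family X J I"
  shows "\<exists>I' :: 'a set set. chi_family X J I' \<and> |I'| \<le>o |I|"
proof (cases "|I| \<le>o |UNIV :: 'a set set|")
  case True
  then obtain f :: "'k \<Rightarrow> 'a set" where f: "inj_on f I"
    using card_of_ordLeq[of I "UNIV :: 'a set set"] by auto
  have "chi_family X J (f ` I)"
  proof (rule chi_family_mono[OF assms])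
    fix B and U :: "'k \<Rightarrow> 'a set"
    assume U: "\<forall>\<alpha> \<in> I. openin X (U \<alpha>) \<and> B \<subseteq> U \<alpha>"
    have inv: "U (the_inv_into I f (f \<alpha>)) = U \<alpha>" if "\<alpha> \<in> I" for \<alpha>
      using the_inv_into_f_f[OF f that] by simp
    show "\<exists>U'. (\<forall>\<beta> \<in> f ` I. openin X (U' \<beta>) \<and> B \<subseteq> U' \<beta>) \<and>
        (\<forall>\<alpha> \<in> I. \<exists>\<beta> \<in> f ` I. U' \<beta> = U \<alpha>)"
      by (rule exI[of _ "\<lambda>\<beta>. U (the_inv_into I f \<beta>)"]) (use U in \<open>auto simp: inv\<close>)
  qed
  moreover have "|f ` I| \<le>o |I|"
    by (rule card_of_image)
  ultimately show ?thesis by blast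
next
  case False
  moreover have "|I| \<le>o |UNIV :: 'a set set| \<or> |UNIV :: 'a set set| \<le>o |I|"
    by (intro ordLeq_total card_of_Well_order)
  ultimately have le: "|UNIV :: 'a set set| \<le>o |I|"
    by metis
  have "I \<noteq> {}"
    using False card_of_empty[of "UNIV :: 'a set set"] by metis
  then obtain \<alpha>0 where \<alpha>0: "\<alpha>0 \<in> I" by blast
  have "chi_family X J (UNIV :: 'a set set)"
  proof (rule chi_family_mono[OF assms])
    fix B and U :: "'k \<Rightarrow> 'a set"
    assume U: "\<forall>\<alpha> \<in> I. openin X (U \<alpha>) \<and> B \<subseteq> U \<alpha>"
    show "\<exists>U'. (\<forall>\<beta> \<in> (UNIV :: 'a set set). openin X (U' \<beta>) \<and> B \<subseteq> U' \<beta>) \<and>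
        (\<forall>\<alpha> \<in> I. \<exists>\<beta> \<in> UNIV. U' \<beta> = U \<alpha>)"
      by (rule exI[of _ "\<lambda>V. if V \<in> U ` I then V else U \<alpha>0"]) (use U \<alpha>0 in auto)
  qed
  with le show ?thesis by blast
qed

lemma is_chi_chi:
  fixes I :: "'k set" and J :: "'a set set"
  assumes "chi_family X J I"
  shows "is_chi X J (chi X J)" and "chi X J \<le>o |I|"
proof -
  let ?R = "{\<kappa> :: 'a set rel. Card_order \<kappa> \<and> chi_family X J (Field \<kappa>)}"
  obtain I' :: "'a set set" where I': "chi_family X J I'" "|I'| \<le>o |I|"
    using chi_family_small[OF assms] by blast
  have mem: "Card_order |I'| \<and> chi_family X J (Field |I'| )"
    unfolding Field_card_of[of I'] using card_of_card_order_on I'(1) by (rule conjI)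
  have "\<exists>\<kappa> \<in> ?R. \<forall>\<mu> \<in> ?R. \<kappa> \<le>o \<mu>"
  proof (rule exists_minim_Card_order)
    show "?R \<noteq> {}"
      using mem by (metis (mono_tags) empty_iff mem_Collect_eq)
    show "\<forall>\<kappa> \<in> ?R. Card_order \<kappa>"
      by simp
  qed
  then have ex: "\<exists>\<kappa>. is_chi X J \<kappa>"
    unfolding is_chi_def bex_simps ball_simps mem_Collect_eq by (simp add: Bex_def)
  have "\<exists>\<kappa> :: 'a set rel. Card_order \<kappa> \<and> chi_family X J (Field \<kappa>)"
    using mem by (rule exI)
  then have "chi X J = (SOME \<kappa>. is_chi X J \<kappa>)"
    unfolding chi_def by (rule if_P)
  with someI_ex[OF ex] show chi: "is_chi X J (chi X J)"
    by simp
  have "chi X J \<le>o |I'|"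
    using chi[unfolded is_chi_def, THEN conjunct2, THEN conjunct2, THEN spec, THEN mp, OF mem] .
  then show "chi X J \<le>o |I|"
    using I'(2) by (rule ordLeq_transitive)
qed


subsection \<open>Sequences, colorings and finite products\<close>

definition closed_discrete :: "'a topology \<Rightarrow> 'a set \<Rightarrow> bool" where
  "closed_discrete X D \<longleftrightarrow> closedin X D \<and> subtopology X D = discrete_topology D"

definition injective_sequence_in :: "'a set \<Rightarrow> (nat \<Rightarrow> 'a) \<Rightarrow> bool" where
  "injective_sequence_in D a \<longleftrightarrow> inj a \<and> range a \<subseteq> D"

text \<open>Sequences are indexed from 0; only the order of the indices matters for the finite products.\<close>

definition FS :: "('a, 'b) monoid_scheme \<Rightarrow> (nat \<Rightarrow> 'a) \<Rightarrow> 'a set" where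
  "FS G a = {foldl (\<otimes>\<^bsub>G\<^esub>) (a n) (map a ns) | n ns. sorted_wrt (<) (n # ns)}"

text \<open>
  Colors are natural numbers, which is no restriction for finitely many colors; the values of a
  coloring of \<open>D\<close> outside \<open>D\<close> are irrelevant.
\<close>

definition finite_coloring :: "'a set \<Rightarrow> ('a \<Rightarrow> nat) \<Rightarrow> bool" where
  "finite_coloring D c \<longleftrightarrow> finite (c ` D)"

definition monochromatic :: "'a set \<Rightarrow> ('a \<Rightarrow> nat) \<Rightarrow> 'a set \<Rightarrow> bool" where
  "monochromatic D c M \<longleftrightarrow> M \<subseteq> D \<and> (\<exists>k. \<forall>x \<in> M. c x = k)"

end

theory Submission
  imports Defs "HOL-Analysis.Function_Topology"
begin

text \<open>
  Call an ultrafilter on \<open>S\<close> openly avoiding if every member of \<open>J\<close> has an open neighbourhood outside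
  it. Such ultrafilters exist because \<open>S\<close> is not \<open>J\<close>-compact, and \<open>|S| < \<chi>(J)\<close> makes them a left ideal
  of \<open>\<beta>S\<close>. Hence \<open>\<beta>S q\<close>, for \<open>q\<close> openly avoiding, contains an openly avoiding idempotent \<open>e\<close>. Take \<open>P\<close>
  open and outside \<open>e\<close>, containing \<open>C\<close> and, if \<open>J\<close> is not near-maximal, a \<open>J\<close>-positive set
  \<open>G - closure U\<close> with \<open>U \<in> e\<close>. For a colour class \<open>M \<in> e\<close> of \<open>S - P\<close>, a maximal family of
  sequences with disjoint finite products inside \<open>M\<close> has \<open>J\<close>-positive union \<open>D\<close>: otherwise
  \<open>M - D \<in> e\<close>, and the Galvin--Glazer argument gives one more sequence. Choosing the \<open>n\<close>-th term outside
  the \<open>n\<close>-th set of an exhaustion makes the sequences, and in the nicely exhaustive case their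
  finite products, locally finite.
\<close>

section \<open>Idempotents in compact right topological semigroups\<close>

locale set_semigroup =
  fixes S :: "'a set" and mult :: "'a \<Rightarrow> 'a \<Rightarrow> 'a" (infixl \<open>\<star>\<close> 70)
  assumes closed: "x \<in> S \<Longrightarrow> y \<in> S \<Longrightarrow> x \<star> y \<in> S"
    and assoc: "x \<in> S \<Longrightarrow> y \<in> S \<Longrightarrow> z \<in> S \<Longrightarrow> x \<star> y \<star> z = x \<star> (y \<star> z)"

text \<open>A minimal compact subsemigroup \<open>M\<close> exists by Zorn's lemma and compactness.
  For \<open>q\<close> in \<open>M\<close>, minimality forces \<open>M q = M\<close>, so the
  \<open>p\<close> in \<open>M\<close> with \<open>p q = q\<close> form a nonempty compact
  subsemigroup; this is again all of \<open>M\<close>, whence \<open>q q = q\<close>.\<close>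

lemma ellis_numakura:
  fixes K :: "'p::t2_space set" and m :: "'p \<Rightarrow> 'p \<Rightarrow> 'p"
  assumes "set_semigroup K m" and "compact K" and "K \<noteq> {}"
    and cont: "\<And>q. q \<in> K \<Longrightarrow> continuous_on K (\<lambda>p. m p q)"
  shows "\<exists>e \<in> K. m e e = e"
proof -
  interpret set_semigroup K m by fact
  define F where "F = {M. M \<subseteq> K \<and> compact M \<and> M \<noteq> {} \<and> (\<forall>x\<in>M. \<forall>y\<in>M. m x y \<in> M)}"
  \<comment> \<open>Complements turn minimal members of \<open>F\<close> into maximal ones, the form
    in which Zorn's lemma is stated.\<close>
  have "\<exists>N\<in>uminus ` F. \<forall>Z\<in>uminus ` F. N \<subseteq> Z \<longrightarrow> Z = N"
  proof (rule subset_Zorn_nonempty)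
    show "uminus ` F \<noteq> {}"
      using assms closed by (auto simp: F_def)
  next
    fix \<C> assume ne: "\<C> \<noteq> {}" and ch: "subset.chain (uminus ` F) \<C>"
    define \<D> where "\<D> = uminus ` \<C>"
    have DF: "\<D> \<subseteq> F" and Dne: "\<D> \<noteq> {}"
      using ne ch by (auto simp: \<D>_def subset.chain_def)
    have "A \<subseteq> B \<or> B \<subseteq> A" if "A \<in> \<C>" "B \<in> \<C>" for A B
      using ch that unfolding subset.chain_def by blast
    then have Dch: "\<forall>A\<in>\<D>. \<forall>B\<in>\<D>. A \<subseteq> B \<or> B \<subseteq> A"
      unfolding \<D>_def by (simp add: Compl_subset_Compl_iff)
    have "K \<inter> \<Inter>\<D> \<noteq> {}"
    proof (rule compact_imp_fip[OF \<open>compact K\<close>])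
      show "closed T" if "T \<in> \<D>" for T
        using that DF by (auto simp: F_def compact_imp_closed)
      fix F' assume F': "finite F'" "F' \<subseteq> \<D>"
      show "K \<inter> \<Inter>F' \<noteq> {}"
      proof (cases "F' = {}")
        case False
        have "\<Inter>F' \<in> F'"
        proof (rule finite_Inf_in[OF F'(1) False])
          fix x y assume "x \<in> F'" "y \<in> F'"
          then have "x \<subseteq> y \<or> y \<subseteq> x" using Dch F'(2) by blast
          with \<open>x \<in> F'\<close> \<open>y \<in> F'\<close> show "x \<inter> y \<in> F'"
            by (auto simp: inf.absorb1 inf.absorb2)
        qed
        then have "\<Inter>F' \<in> F" using F'(2) DF by blast
        then have "\<Inter>F' \<subseteq> K" "\<Inter>F' \<noteq> {}" unfolding F_def by blast+
        then show ?thesis by (simp add: inf.absorb2)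
      qed (use \<open>K \<noteq> {}\<close> in simp)
    qed
    then have 1: "\<Inter>\<D> \<noteq> {}" by blast
    have 2: "\<Inter>\<D> \<subseteq> K" using Dne DF unfolding F_def by blast
    have "closed (\<Inter>\<D>)"
      using DF unfolding F_def by (blast intro: compact_imp_closed)
    with 2 have 3: "compact (\<Inter>\<D>)"
      using compact_Int_closed[OF \<open>compact K\<close>, of "\<Inter>\<D>"] by (simp add: inf.absorb2)
    have 4: "\<forall>x\<in>\<Inter>\<D>. \<forall>y\<in>\<Inter>\<D>. m x y \<in> \<Inter>\<D>"
      using DF unfolding F_def by blast
    have "\<Inter>\<D> \<in> F" unfolding F_def using 1 2 3 4 by blast
    moreover have "\<Union>\<C> = - \<Inter>\<D>" by (auto simp: \<D>_def)
    ultimately show "\<Union>\<C> \<in> uminus ` F" by blast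
  qed
  then obtain M where M: "M \<in> F" and min: "\<And>Z. Z \<in> F \<Longrightarrow> Z \<subseteq> M \<Longrightarrow> Z = M"
    by auto
  have MK: "M \<subseteq> K" and Mc: "compact M" and Mm: "\<And>x y. x \<in> M \<Longrightarrow> y \<in> M \<Longrightarrow> m x y \<in> M"
    using M by (auto simp: F_def)
  obtain q where q: "q \<in> M" using M by (auto simp: F_def)
  have cM: "continuous_on M (\<lambda>p. m p q)"
    using continuous_on_subset[OF cont MK] q MK by blast
  have "(\<lambda>p. m p q) ` M \<in> F"
  proof -
    have "m (m a q) (m b q) \<in> (\<lambda>p. m p q) ` M" if "a \<in> M" "b \<in> M" for a b
    proof -
      have "m (m a q) (m b q) = m (m (m a q) b) q"
        using that q MK by (simp add: assoc closed subset_iff)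
      then show ?thesis using that q Mm by blast
    qed
    moreover have "(\<lambda>p. m p q) ` M \<subseteq> K" using Mm q MK by blast
    ultimately show ?thesis
      using compact_continuous_image[OF cM Mc] q unfolding F_def by blast
  qed
  then have "(\<lambda>p. m p q) ` M = M"
    using Mm q by (intro min) auto
  then obtain r where r: "r \<in> M" "m r q = q" using q by (metis imageE)
  define N where "N = {p \<in> M. m p q = q}"
  have "closedin (top_of_set M) {p \<in> M. m p q \<in> {q}}"
    using continuous_closedin_preimage[OF cM, of "{q}"] by (simp add: vimage_def Int_def)
  then have "compact N"
    using Mc by (auto simp: N_def intro: closedin_compact)
  moreover have "m x y \<in> N" if "x \<in> N" "y \<in> N" for x y
    using that q MK Mm by (auto simp: N_def assoc subset_iff)
  ultimately have "N \<in> F"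
    using r MK by (auto simp: F_def N_def)
  then have "N = M" by (intro min) (auto simp: N_def)
  then show ?thesis using q MK by (auto simp: N_def)
qed


section \<open>The semigroup of ultrafilters\<close>

text \<open>Ultrafilters are points of the power of \<open>bool\<close> indexed by all sets;
  \<open>ellis_numakura\<close> is applied there and asks for a Hausdorff type.\<close>

instance "fun" :: (type, t2_space) t2_space
proof
  fix f g :: "'a \<Rightarrow> 'b"
  assume "f \<noteq> g"
  then obtain x where "f x \<noteq> g x" by blast
  then obtain U V where UV: "open U" "open V" "f x \<in> U" "g x \<in> V" "U \<inter> V = {}"
    using hausdorff by metis
  have "open ((\<lambda>h. h x) -` U)" "open ((\<lambda>h. h x) -` V)"
    using UV(1,2) by (auto intro: open_vimage)
  with UV show "\<exists>U V. open U \<and> open V \<and> f \<in> U \<and> g \<in> V \<and> U \<inter> V = {}"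
    by (intro exI[of _ "(\<lambda>h. h x) -` U"] exI[of _ "(\<lambda>h. h x) -` V"]) auto
qed

text \<open>An ultrafilter is encoded as a Boolean homomorphism from sets to \<open>bool\<close>, so
  that it is a point of a product space. Those with \<open>p S\<close> form
  \<open>\<beta>S\<close>.\<close>

definition ultra :: "('a set \<Rightarrow> bool) \<Rightarrow> bool" where
  "ultra p \<longleftrightarrow> (\<forall>A B. p (A \<inter> B) \<longleftrightarrow> p A \<and> p B) \<and> (\<forall>A. p (- A) \<longleftrightarrow> \<not> p A)"

lemma ultra_Int: "ultra p \<Longrightarrow> p (A \<inter> B) \<longleftrightarrow> p A \<and> p B"
  and ultra_Compl: "ultra p \<Longrightarrow> p (- A) \<longleftrightarrow> \<not> p A"
  by (simp_all add: ultra_def)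

lemma ultra_empty: "ultra p \<Longrightarrow> \<not> p {}"
  by (metis Compl_disjoint ultra_Compl ultra_Int)

lemma ultra_mono: "ultra p \<Longrightarrow> p A \<Longrightarrow> A \<subseteq> B \<Longrightarrow> p B"
  by (metis inf.absorb1 ultra_Int)

lemma ultra_Un: "ultra p \<Longrightarrow> p (A \<union> B) \<longleftrightarrow> p A \<or> p B"
  by (metis compl_sup ultra_Compl ultra_Int)

lemma ultra_Diff: "ultra p \<Longrightarrow> p (A - B) \<longleftrightarrow> p A \<and> \<not> p B"
  by (metis Diff_eq ultra_Compl ultra_Int)

text \<open>Lets points outside \<open>S\<close>, where the algebraic laws may fail, be
  ignored.\<close>

lemma ultra_cong: "ultra p \<Longrightarrow> p S \<Longrightarrow> A \<inter> S = B \<inter> S \<Longrightarrow> p A \<longleftrightarrow> p B"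
  by (metis ultra_Int)

lemma ultra_finite_UN:
  assumes "ultra p" "finite I" "p (\<Union>i\<in>I. A i)"
  shows "\<exists>i\<in>I. p (A i)"
  using assms(2,3) by (induction I) (auto simp: ultra_empty ultra_Un assms(1))

lemma ultra_principal: "ultra (\<lambda>A. x \<in> A)"
  by (auto simp: ultra_def)

lemma ultrafilter_on_ultra:
  assumes "ultra p" "p T"
  shows "ultrafilter_on T {A. A \<subseteq> T \<and> p A}"
  using assms by (auto simp: ultrafilter_on_def ultra_Int ultra_Diff ultra_empty intro: ultra_mono)

lemma compact_UNIV_predicates: "compact (UNIV :: ('a \<Rightarrow> bool) set)"
proof -
  have "compact_space (euclidean :: bool topology)"
    by (simp add: compact_space_def finite_imp_compact)
  then have "compact_space (product_topology (\<lambda>_::'a. euclidean :: bool topology) UNIV)"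
    by (simp add: compact_space_product_topology)
  then show ?thesis
    by (simp add: euclidean_product_topology compact_space_def)
qed

lemma closed_eval:
  fixes A :: 'a
  shows "closed {p. p A}" "closed {p. \<not> p A}" "open {p. p A}" "open {p. \<not> p A}"
proof -
  have c: "continuous_on UNIV (\<lambda>p :: 'a \<Rightarrow> bool. p A)" by simp
  show op: "open {p. p A}" "open {p. \<not> p A}"
    using open_vimage[OF _ c, of "{True}"] open_vimage[OF _ c, of "{False}"]
    by (simp_all add: vimage_def open_discrete)
  show "closed {p. p A}" "closed {p. \<not> p A}"
    using op by (simp_all add: closed_def Collect_neg_eq)
qed

text \<open>For fixed sets, each clause of \<open>ultra\<close> constrains finitely many
  coordinates, and evaluation at a set is clopen; so the clauses cut out a closed subset of a
  compact product.\<close>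

lemma compact_ultra: "compact {p. ultra p \<and> p S}"
proof -
  have "closed {p. ultra p \<and> p S}"
    unfolding ultra_def iff_conv_conj_imp
    by (intro closed_Collect_conj closed_Collect_all closed_Collect_imp closed_Collect_disj
        open_Collect_conj closed_eval)
  then show ?thesis
    using compact_Int_closed[OF compact_UNIV_predicates] by auto
qed

text \<open>Compactness of \<open>\<beta>S\<close>: a point of \<open>S\<close> outside a finite
  union gives a principal ultrafilter that witnesses the finite intersection property.\<close>

lemma ex_ultra_avoiding:
  assumes "\<And>F. finite F \<Longrightarrow> F \<subseteq> \<U> \<Longrightarrow> \<not> S \<subseteq> \<Union>F"
  shows "\<exists>p. ultra p \<and> p S \<and> (\<forall>U\<in>\<U>. \<not> p U)"
proof -
  have "{p. ultra p \<and> p S} \<inter> (\<Inter>U\<in>\<U>. {p. \<not> p U}) \<noteq> {}"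
  proof (rule compact_imp_fip_image[OF compact_ultra])
    fix F assume "finite F" "F \<subseteq> \<U>"
    then obtain x where "x \<in> S" "x \<notin> \<Union>F" using assms by blast
    then have "(\<lambda>A. x \<in> A) \<in> {p. ultra p \<and> p S} \<inter> (\<Inter>U\<in>F. {p. \<not> p U})"
      using ultra_principal[of x] by auto
    then show "{p. ultra p \<and> p S} \<inter> (\<Inter>U\<in>F. {p. \<not> p U}) \<noteq> {}" by blast
  qed (rule closed_eval)
  then show ?thesis by auto
qed

text \<open>The usual extension of \<open>m\<close> to ultrafilters. Quantifying with
  \<open>p\<close> on the outside makes the product continuous in \<open>p\<close> for fixed
  \<open>q\<close>, the side on which \<open>ellis_numakura\<close> needs continuity.\<close>

definition conv :: "('a \<Rightarrow> 'a \<Rightarrow> 'a) \<Rightarrow> ('a set \<Rightarrow> bool) \<Rightarrow> ('a set \<Rightarrow> bool) \<Rightarrow> 'a set \<Rightarrow> bool" where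
  "conv m p q A = p {x. q {y. m x y \<in> A}}"

text \<open>Each coordinate of the image is the evaluation of \<open>p\<close> at one fixed
  set.\<close>

lemma continuous_conv: "continuous_on T (\<lambda>p. conv m p q)"
  unfolding conv_def
  by (intro continuous_on_coordinatewise_then_product
      continuous_on_subset[OF continuous_on_product_coordinates subset_UNIV])

lemma ultra_conv:
  assumes "ultra p" "ultra q"
  shows "ultra (conv m p q)"
  unfolding ultra_def conv_def
proof (intro conjI allI)
  fix A B
  have "{x. q {y. m x y \<in> A \<inter> B}} = {x. q {y. m x y \<in> A}} \<inter> {x. q {y. m x y \<in> B}}"
    using ultra_Int[OF assms(2), symmetric] by (auto simp: Int_def)
  then show "p {x. q {y. m x y \<in> A \<inter> B}} = (p {x. q {y. m x y \<in> A}} \<and> p {x. q {y. m x y \<in> B}})"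
    by (simp add: ultra_Int[OF assms(1)])
  have "{x. q {y. m x y \<in> - A}} = - {x. q {y. m x y \<in> A}}"
    using ultra_Compl[OF assms(2), symmetric] by (auto simp: Collect_neg_eq)
  then show "p {x. q {y. m x y \<in> - A}} = (\<not> p {x. q {y. m x y \<in> A}})"
    by (simp add: ultra_Compl[OF assms(1)])
qed

context set_semigroup
begin

lemma conv_supported:
  assumes "ultra p" "p S" "ultra q" "q S"
  shows "conv (\<star>) p q S"
  unfolding conv_def
  by (rule ultra_mono[OF assms(1,2)]) (auto intro: ultra_mono[OF assms(3,4)] closed)

text \<open>Read as nested quantifiers, both sides use \<open>p\<close>, \<open>q\<close>,
  \<open>r\<close> in the same order and differ only in the bracketing of \<open>x\<close>,
  \<open>y\<close>, \<open>z\<close>, which is immaterial on \<open>S\<close>.\<close>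

lemma conv_assoc:
  assumes "ultra p" "p S" "ultra q" "q S" "ultra r" "r S"
  shows "conv (\<star>) (conv (\<star>) p q) r = conv (\<star>) p (conv (\<star>) q r)"
proof
  fix A
  have r: "r {z. x \<star> y \<star> z \<in> A} = r {z. x \<star> (y \<star> z) \<in> A}" if "x \<in> S" "y \<in> S" for x y
    using that by (intro ultra_cong[OF assms(5,6)]) (auto simp: assoc)
  have q: "q {y. r {z. x \<star> y \<star> z \<in> A}} = q {y. r {z. x \<star> (y \<star> z) \<in> A}}" if "x \<in> S" for x
    using that r by (intro ultra_cong[OF assms(3,4)]) auto
  have "p {x. q {y. r {z. x \<star> y \<star> z \<in> A}}} = p {x. q {y. r {z. x \<star> (y \<star> z) \<in> A}}}"
    using q by (intro ultra_cong[OF assms(1,2)]) auto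
  then show "conv (\<star>) (conv (\<star>) p q) r A = conv (\<star>) p (conv (\<star>) q r) A"
    by (simp add: conv_def)
qed

text \<open>The products \<open>p q\<close> form a continuous image of \<open>\<beta>S\<close>,
  hence a compact set, and associativity makes it a left ideal, so \<open>ellis_numakura\<close>
  applies. The factor \<open>p\<close> is recorded so that properties inherited by left multiples of
  \<open>q\<close> pass to \<open>e\<close>.\<close>

lemma ex_idempotent_in_left_ideal:
  assumes q: "ultra q" "q S"
  shows "\<exists>p e. ultra p \<and> p S \<and> e = conv (\<star>) p q \<and> ultra e \<and> e S \<and> conv (\<star>) e e = e"
proof -
  let ?\<beta> = "{p. ultra p \<and> p S}"
  define K where "K = (\<lambda>p. conv (\<star>) p q) ` ?\<beta>"
  have K\<beta>: "K \<subseteq> ?\<beta>"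
    using q by (auto simp: K_def ultra_conv conv_supported)
  have "\<exists>e\<in>K. conv (\<star>) e e = e"
  proof (rule ellis_numakura[where m = "conv (\<star>)"])
    show "set_semigroup K (conv (\<star>))"
    proof
      fix x y assume x: "x \<in> K" and y: "y \<in> K"
      then obtain p where p: "p \<in> ?\<beta>" "y = conv (\<star>) p q" by (auto simp: K_def)
      have "conv (\<star>) x y = conv (\<star>) (conv (\<star>) x p) q"
        unfolding p(2) using x p K\<beta> q by (subst conv_assoc) auto
      moreover have "conv (\<star>) x p \<in> ?\<beta>"
        using x p K\<beta> by (auto simp: ultra_conv conv_supported)
      ultimately show "conv (\<star>) x y \<in> K" by (auto simp: K_def)
    next
      fix x y z assume "x \<in> K" "y \<in> K" "z \<in> K"
      then show "conv (\<star>) (conv (\<star>) x y) z = conv (\<star>) x (conv (\<star>) y z)"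
        using K\<beta> by (intro conv_assoc) auto
    qed
    show "compact K"
      unfolding K_def by (intro compact_continuous_image continuous_conv compact_ultra)
    show "K \<noteq> {}" using q by (auto simp: K_def)
  qed (rule continuous_conv)
  then show ?thesis using K\<beta> by (auto simp: K_def)
qed

text \<open>
  The invariant of the Galvin--Glazer construction: it passes from \<open>M\<close> to \<open>M \<inter> a\<^sup>-\<^sup>1M\<close> for \<open>a \<in> M\<close>.
\<close>

definition idem_large :: "('a set \<Rightarrow> bool) \<Rightarrow> 'a set \<Rightarrow> bool" where
  "idem_large e M \<longleftrightarrow> M \<subseteq> S \<and> e M \<and> (\<forall>x\<in>M. e {y. x \<star> y \<in> M})"

text \<open>Idempotence puts into \<open>e\<close> the star of any large \<open>A\<close>, that is,
  the \<open>x\<close> in \<open>A\<close> with x^-1 A large. If \<open>x\<close> is in the star of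
  \<open>M\<close>, then \<open>x\<close> multiplies the star of x^-1 M, cut down to
  \<open>S\<close>, into the star of \<open>M\<close>.\<close>

lemma idem_large_star:
  assumes "ultra e" "e S" and idem: "conv (\<star>) e e = e" and M: "e M" "M \<subseteq> S"
  shows "idem_large e {x\<in>M. e {y. x \<star> y \<in> M}}"
proof -
  let ?M = "{x\<in>M. e {y. x \<star> y \<in> M}}"
  have star: "e {x\<in>A. e {y. x \<star> y \<in> A}}" if "e A" for A
  proof -
    have "e {x. e {y. x \<star> y \<in> A}}"
      using that fun_cong[OF idem, of A] by (simp add: conv_def)
    then have "e (A \<inter> {x. e {y. x \<star> y \<in> A}})"
      using that \<open>ultra e\<close> by (simp add: ultra_Int)
    then show ?thesis by (simp add: Int_def)
  qed
  have "e {y. x \<star> y \<in> ?M}" if "x \<in> ?M" for x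
  proof -
    let ?A = "{y. x \<star> y \<in> M} \<inter> S"
    have "e ?A" using that assms(1,2) by (simp add: ultra_Int)
    then have "e {y\<in>?A. e {z. y \<star> z \<in> ?A}}" by (rule star)
    moreover have "{y\<in>?A. e {z. y \<star> z \<in> ?A}} \<subseteq> {y. x \<star> y \<in> ?M}"
    proof
      fix y assume y: "y \<in> {y\<in>?A. e {z. y \<star> z \<in> ?A}}"
      then have "e ({z. y \<star> z \<in> ?A} \<inter> S)"
        using assms(1,2) by (simp add: ultra_Int)
      moreover have "{z. y \<star> z \<in> ?A} \<inter> S \<subseteq> {z. x \<star> y \<star> z \<in> M}"
        using that y M by (auto simp: assoc)
      ultimately have "e {z. x \<star> y \<star> z \<in> M}"
        using ultra_mono[OF \<open>ultra e\<close>] by blast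
      with y show "y \<in> {y. x \<star> y \<in> ?M}" by simp
    qed
    ultimately show ?thesis by (rule ultra_mono[OF \<open>ultra e\<close>])
  qed
  then show ?thesis using star[OF M(1)] M(2) by (auto simp: idem_large_def)
qed

text \<open>For \<open>x\<close> in the new set both \<open>x\<close> and \<open>a x\<close> lie in
  \<open>M\<close>, so x^-1 M and (a x)^-1 M are in \<open>e\<close>, and so is their
  intersection.\<close>

lemma idem_large_step:
  assumes "ultra e" and M: "idem_large e M" and a: "a \<in> M"
  shows "idem_large e (M \<inter> {y. a \<star> y \<in> M})"
proof -
  have S: "M \<subseteq> S" and eS: "e S" using M ultra_mono[OF \<open>ultra e\<close>] by (auto simp: idem_large_def)
  have "e {y. x \<star> y \<in> M \<inter> {y. a \<star> y \<in> M}}" if x: "x \<in> M" "a \<star> x \<in> M" for x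
  proof -
    have "e ({y. x \<star> y \<in> M} \<inter> {y. a \<star> x \<star> y \<in> M} \<inter> S)"
      using M x eS \<open>ultra e\<close> by (simp add: ultra_Int idem_large_def)
    moreover have "{y. x \<star> y \<in> M} \<inter> {y. a \<star> x \<star> y \<in> M} \<inter> S \<subseteq> {y. x \<star> y \<in> M \<inter> {y. a \<star> y \<in> M}}"
      using S a x by (auto simp: assoc subset_iff)
    ultimately show ?thesis by (rule ultra_mono[OF \<open>ultra e\<close>])
  qed
  then show ?thesis
    using M a \<open>ultra e\<close> by (auto simp: idem_large_def ultra_Int)
qed

text \<open>Terms are picked recursively from shrinking large sets: after \<open>a n\<close> is
  taken from \<open>L n\<close>, only those \<open>y\<close> in \<open>L n\<close> are kept for
  which \<open>a n\<close> times \<open>y\<close> stays in \<open>L n\<close>. The sets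
  \<open>N n\<close> allow a separate condition on each term.\<close>

lemma galvin_glazer:
  assumes e: "ultra e" "e S" "conv (\<star>) e e = e" and M: "e M" "M \<subseteq> S"
    and N: "\<And>n. e (N n)" and fin: "\<And>x. \<not> e {x}"
  shows "\<exists>a :: nat \<Rightarrow> 'a. inj a \<and> (\<forall>n. a n \<in> N n) \<and>
    (\<forall>n ns. sorted_wrt (<) (n # ns) \<longrightarrow> foldl (\<star>) (a n) (map a ns) \<in> M)"
proof -
  define M0 where "M0 = {x\<in>M. e {y. x \<star> y \<in> M}}"
  have M0: "idem_large e M0" using idem_large_star[OF e M] by (simp add: M0_def)
  text \<open>States are triples: the current large set, the element chosen from it, the elements used
    so far.\<close>
  define good where "good n t \<longleftrightarrow> (case t of (L, a, D) \<Rightarrow>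
    idem_large e L \<and> L \<subseteq> M0 \<and> finite D \<and> a \<in> L \<and> a \<in> N n \<and> a \<notin> D)"
    for n :: nat and t :: "'a set \<times> 'a \<times> 'a set"
  define succ where "succ t t' \<longleftrightarrow> (case t of (L, a, D) \<Rightarrow> case t' of (L', a', D') \<Rightarrow>
    L' = L \<inter> {y. a \<star> y \<in> L} \<and> D' = insert a D)" for t t' :: "'a set \<times> 'a \<times> 'a set"
  \<comment> \<open>Finite sets are not in \<open>e\<close> because singletons are not; hence a
    choice can always avoid the terms used so far, which yields injectivity.\<close>
  have pick: "\<exists>a. a \<in> L \<and> a \<in> N n \<and> a \<notin> D" if "idem_large e L" "finite D" for L n D
  proof -
    have "\<not> e D"
    proof
      assume "e D"
      then have "e (\<Union>x\<in>D. {x})" by simp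
      from ultra_finite_UN[OF e(1) that(2) this] fin show False by blast
    qed
    then have "e (L \<inter> N n - D)"
      using that N e(1) by (simp add: ultra_Int ultra_Diff idem_large_def)
    then have "L \<inter> N n - D \<noteq> {}" using ultra_empty[OF e(1)] by metis
    then show ?thesis by blast
  qed
  have "\<exists>f. \<forall>n. good n (f n) \<and> succ (f n) (f (Suc n))"
  proof (rule dependent_nat_choice)
    show "\<exists>t. good 0 t"
      using pick[OF M0, of "{}" 0] M0 by (auto simp: good_def)
  next
    fix t n assume g: "good n t"
    obtain L a D where t: "t = (L, a, D)" by (cases t)
    have "idem_large e (L \<inter> {y. a \<star> y \<in> L})"
      using g idem_large_step[OF e(1)] by (simp add: good_def t)
    moreover have "finite (insert a D)" using g by (simp add: good_def t)
    ultimately obtain b where "b \<in> L \<inter> {y. a \<star> y \<in> L}" "b \<in> N (Suc n)" "b \<notin> insert a D"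
      using pick by blast
    with g have "good (Suc n) (L \<inter> {y. a \<star> y \<in> L}, b, insert a D)"
      using idem_large_step[OF e(1)] by (auto simp: good_def t)
    moreover have "succ t (L \<inter> {y. a \<star> y \<in> L}, b, insert a D)" by (simp add: succ_def t)
    ultimately show "\<exists>t'. good (Suc n) t' \<and> succ t t'" by blast
  qed
  then obtain f where f: "\<And>n. good n (f n)" "\<And>n. succ (f n) (f (Suc n))" by blast
  define L where "L n = fst (f n)" for n
  define a where "a n = fst (snd (f n))" for n
  define D where "D n = snd (snd (f n))" for n
  have fn: "f n = (L n, a n, D n)" for n by (simp add: L_def a_def D_def)
  have L: "idem_large e (L n)" "L n \<subseteq> M0" "a n \<in> L n" "a n \<in> N n" "a n \<notin> D n" for n
    using f(1)[of n] by (auto simp: good_def fn)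
  have LSuc: "L (Suc n) = L n \<inter> {y. a n \<star> y \<in> L n}" and DSuc: "D (Suc n) = insert (a n) (D n)" for n
    using f(2)[of n] by (auto simp: succ_def fn)
  have Lmono: "L n \<subseteq> L m" if "m \<le> n" for m n
    using that by (induction rule: dec_induct) (auto simp: LSuc)
  have Dmono: "D m \<subseteq> D n" if "m \<le> n" for m n
    using that by (induction rule: dec_induct) (auto simp: DSuc)
  have LS: "L n \<subseteq> S" for n using L(1) by (simp add: idem_large_def)
  have aD: "a m \<in> D n" if "m < n" for m n
    using Dmono[of "Suc m" n] that by (auto simp: DSuc)
  have "inj a"
    by (rule linorder_injI) (metis aD L(5))
  text \<open>Each partial product \<open>x\<close> with indices below \<open>k\<close> satisfies \<open>x L\<^sub>k \<subseteq> M0\<close>.\<close>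
  have prod: "foldl (\<star>) x (map a ns) \<in> M0"
    if "x \<in> M0" "\<forall>y\<in>L k. x \<star> y \<in> M0" "sorted_wrt (<) ns" "\<forall>n\<in>set ns. k \<le> n" for x k ns
    using that
  proof (induction ns arbitrary: x k)
    case (Cons n ns)
    have kn: "k \<le> n" using Cons.prems by simp
    have 1: "x \<star> a n \<in> M0"
      using Cons.prems(2) L(3) Lmono[OF kn] by blast
    have "x \<in> S" using Cons.prems(1) M(2) by (auto simp: M0_def)
    have 2: "\<forall>y\<in>L (Suc n). x \<star> a n \<star> y \<in> M0"
    proof
      fix y assume y: "y \<in> L (Suc n)"
      then have "a n \<star> y \<in> L k" using Lmono[OF kn] by (auto simp: LSuc)
      moreover have "a n \<in> S" "y \<in> S" using y LS L(3) by blast+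
      ultimately show "x \<star> a n \<star> y \<in> M0"
        using Cons.prems(2) \<open>x \<in> S\<close> by (simp add: assoc)
    qed
    show ?case
      using Cons.IH[OF 1 2] Cons.prems(3) by (simp add: Suc_le_eq)
  qed simp
  have "foldl (\<star>) (a n) (map a ns) \<in> M" if "sorted_wrt (<) (n # ns)" for n ns
  proof -
    have "foldl (\<star>) (a n) (map a ns) \<in> M0"
    proof (rule prod)
      show "a n \<in> M0" using L(2,3) by blast
      show "\<forall>y\<in>L (Suc n). a n \<star> y \<in> M0" using L(2) by (auto simp: LSuc)
    qed (use that in \<open>auto simp: Suc_le_eq\<close>)
    then show ?thesis by (simp add: M0_def)
  qed
  with \<open>inj a\<close> L(4) show ?thesis by blast
qed

end


section \<open>Closed discrete sets\<close>

text \<open>Every subset of \<open>D\<close> meets each \<open>A i\<close> in a finite set, closed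
  by T1, so its complement is a union of open sets. Once all subsets of \<open>D\<close> are closed,
  \<open>D\<close> is discrete.\<close>

lemma closed_discrete_if_locally_finite:
  assumes T1: "t1_space X" and D: "D \<subseteq> topspace X"
    and A: "\<And>i::nat. openin X (A i)" "(\<Union>i. A i) = topspace X" and fin: "\<And>i. finite (D \<inter> A i)"
  shows "closed_discrete X D"
proof -
  have closed: "closedin X E" if "E \<subseteq> D" for E
  proof -
    have "topspace X - E = (\<Union>i. A i - (E \<inter> A i))" using A(2) by auto
    moreover have "openin X (A i - (E \<inter> A i))" for i
    proof (intro openin_diff A)
      have "finite (E \<inter> A i)" using fin[of i] by (rule rev_finite_subset) (use that in blast)
      then show "closedin X (E \<inter> A i)"
        using T1 D that t1_space_closedin_finite[of X] by blast
    qed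
    ultimately have "openin X (topspace X - E)" by auto
    then show ?thesis using that D by (auto simp: closedin_def)
  qed
  have "discrete_topology D = subtopology X D"
    unfolding discrete_topology_unique
  proof (intro conjI ballI)
    show "topspace (subtopology X D) = D" using D by auto
    fix x assume x: "x \<in> D"
    have "openin X (topspace X - (D - {x}))" using closed[of "D - {x}"] by (auto simp: closedin_def)
    then have "openin (subtopology X D) ((topspace X - (D - {x})) \<inter> D)"
      by (auto simp: openin_subtopology)
    moreover have "(topspace X - (D - {x})) \<inter> D = {x}" using x D by auto
    ultimately show "openin (subtopology X D) {x}" by simp
  qed
  then show ?thesis using closed[of D] by (simp add: closed_discrete_def)
qed

lemma range_subset_FS: "range a \<subseteq> FS G a"
proof
  fix x assume "x \<in> range a"
  then obtain n where "x = a n" by blast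
  then have "x = foldl (\<otimes>\<^bsub>G\<^esub>) (a n) (map a [])" "sorted_wrt (<) [n]" by auto
  then show "x \<in> FS G a" unfolding FS_def by blast
qed

text \<open>The last factor \<open>a k\<close> of a product lies in the left ideal
  \<open>S - A k\<close>, hence so does the product. A product in \<open>A i\<close> therefore has
  last index below \<open>i\<close>, which leaves finitely many lists of indices.\<close>

lemma FS_finite_meet:
  assumes S: "subsemigroup G S" and a: "range a \<subseteq> S"
    and ideal: "\<And>i. left_ideal_in G S (S - A i)"
    and mono: "\<And>i j. i \<le> j \<Longrightarrow> A i \<subseteq> A j" and out: "\<And>n. a n \<notin> A n"
  shows "finite (FS G a \<inter> A i)"
proof -
  have inS: "foldl (\<otimes>\<^bsub>G\<^esub>) x (map a ns) \<in> S" if "x \<in> S" for x ns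
    using that
  proof (induction ns arbitrary: x)
    case (Cons n ns)
    have "x \<otimes>\<^bsub>G\<^esub> a n \<in> S" using Cons.prems a S by (auto simp: subsemigroup_def)
    then show ?case using Cons.IH by simp
  qed simp
  have notin: "foldl (\<otimes>\<^bsub>G\<^esub>) (a n) (map a ns) \<notin> A (last (n # ns))" for n ns
  proof (cases ns rule: rev_cases)
    case (snoc ms k)
    have "foldl (\<otimes>\<^bsub>G\<^esub>) (a n) (map a ms) \<otimes>\<^bsub>G\<^esub> a k \<in> S <#>\<^bsub>G\<^esub> (S - A k)"
      unfolding set_mult_def using inS[of "a n" ms] a out[of k] by blast
    then show ?thesis using ideal[of k] snoc by (auto simp: left_ideal_in_def)
  qed (simp add: out)
  define Ls where "Ls = {xs. set xs \<subseteq> {..<i} \<and> distinct xs}"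
  have "FS G a \<inter> A i \<subseteq> (\<lambda>xs. foldl (\<otimes>\<^bsub>G\<^esub>) (a (hd xs)) (map a (tl xs))) ` Ls"
  proof
    fix x assume "x \<in> FS G a \<inter> A i"
    then obtain n ns where x: "x = foldl (\<otimes>\<^bsub>G\<^esub>) (a n) (map a ns)" "x \<in> A i"
      and s: "sorted_wrt (<) (n # ns)" by (auto simp: FS_def)
    have "\<not> i \<le> last (n # ns)" using notin[of n ns] mono[of i "last (n # ns)"] x by blast
    moreover have "m \<le> last (n # ns)" if "m \<in> set (n # ns)" for m
    proof (cases "n # ns" rule: rev_cases)
      case (snoc ms k)
      then show ?thesis using s that by (auto simp: sorted_wrt_append)
    qed simp
    ultimately have "n # ns \<in> Ls"
      using s strict_sorted_iff[of "n # ns"] by (fastforce simp: Ls_def)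
    then show "x \<in> (\<lambda>xs. foldl (\<otimes>\<^bsub>G\<^esub>) (a (hd xs)) (map a (tl xs))) ` Ls"
      using x by (intro image_eqI[of _ _ "n # ns"]) auto
  qed
  moreover have "finite Ls" unfolding Ls_def by (rule finite_subset_distinct) simp
  ultimately show ?thesis by (meson finite_imageI finite_subset)
qed


section \<open>The left ideal of ultrafilters that every member of \<open>J\<close> avoids openly\<close>

definition openly_avoids :: "'a topology \<Rightarrow> 'a set set \<Rightarrow> ('a set \<Rightarrow> bool) \<Rightarrow> bool" where
  "openly_avoids X J p \<longleftrightarrow> (\<forall>A\<in>J. \<exists>U. openin X U \<and> A \<subseteq> U \<and> \<not> p U)"

lemma openly_avoids_notin: "ultra p \<Longrightarrow> openly_avoids X J p \<Longrightarrow> A \<in> J \<Longrightarrow> \<not> p A"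
  unfolding openly_avoids_def by (metis ultra_mono)

text \<open>
  Given \<open>A \<in> J\<close>, the smallness of \<open>S\<close> yields \<open>B \<supseteq> A\<close> in \<open>J\<close> and a single open \<open>W \<supseteq> B\<close> contained
  modulo \<open>J\<close> in all the sets \<open>x U\<^sub>x\<close>, \<open>x \<in> S\<close>, where \<open>U\<^sub>x \<supseteq> x\<^sup>-\<^sup>1B\<close> is an open set outside \<open>q\<close>.
\<close>

lemma openly_avoids_conv:
  assumes LT: "left_topological_group G X" and JI: "set_ideal (carrier G) J"
    and LI: "left_invariant G J" and SG: "S \<subseteq> carrier G" and chi: "\<not> chi_family X J S"
    and p: "ultra p" "p S" and q: "ultra q" "q S" "openly_avoids X J q"
  shows "openly_avoids X J (conv (\<otimes>\<^bsub>G\<^esub>) p q)"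
  unfolding openly_avoids_def
proof
  interpret group G using LT by (simp add: left_topological_group_def)
  have top: "topspace X = carrier G" using LT by (simp add: left_topological_group_def)
  have JG: "A \<subseteq> carrier G" if "A \<in> J" for A using that JI by (auto simp: set_ideal_def)
  have shift: "(\<lambda>a. x \<otimes>\<^bsub>G\<^esub> a) ` A \<in> J" if "A \<in> J" "x \<in> carrier G" for A x
  proof -
    have "(\<lambda>a. x \<otimes>\<^bsub>G\<^esub> a) ` A = x <#\<^bsub>G\<^esub> A" by (auto simp: l_coset_def)
    then show ?thesis using LI that by (simp add: left_invariant_def)
  qed
  fix A assume "A \<in> J"
  obtain B where B: "B \<in> J" "A \<subseteq> B"
    and W: "\<And>U. \<forall>x\<in>S. openin X (U x) \<and> B \<subseteq> U x \<Longrightarrow>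
      \<exists>W. openin X W \<and> B \<subseteq> W \<and> (\<forall>x\<in>S. W - U x \<in> J)"
    using chi \<open>A \<in> J\<close> unfolding chi_family_def by metis
  have "\<forall>x\<in>S. \<exists>U. openin X U \<and> (\<lambda>a. inv\<^bsub>G\<^esub> x \<otimes>\<^bsub>G\<^esub> a) ` B \<subseteq> U \<and> \<not> q U"
    using q(3) shift[OF B(1)] SG unfolding openly_avoids_def by (meson inv_closed subsetD)
  then obtain V where V: "\<And>x. x \<in> S \<Longrightarrow>
      openin X (V x) \<and> (\<lambda>a. inv\<^bsub>G\<^esub> x \<otimes>\<^bsub>G\<^esub> a) ` B \<subseteq> V x \<and> \<not> q (V x)"
    by metis
  define U where "U x = {y \<in> topspace X. inv\<^bsub>G\<^esub> x \<otimes>\<^bsub>G\<^esub> y \<in> V x}" for x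
  have "\<forall>x\<in>S. openin X (U x) \<and> B \<subseteq> U x"
  proof
    fix x assume x: "x \<in> S"
    then have "continuous_map X X (\<lambda>y. inv\<^bsub>G\<^esub> x \<otimes>\<^bsub>G\<^esub> y)"
      using LT SG by (auto simp: left_topological_group_def)
    then have "openin X (U x)"
      unfolding U_def using V[OF x] by (intro openin_continuous_map_preimage) auto
    moreover have "B \<subseteq> U x" using V[OF x] JG[OF B(1)] by (auto simp: U_def top)
    ultimately show "openin X (U x) \<and> B \<subseteq> U x" by simp
  qed
  from W[OF this] obtain W where W: "openin X W" "B \<subseteq> W" "\<And>x. x \<in> S \<Longrightarrow> W - U x \<in> J"
    by blast
  have WG: "W \<subseteq> carrier G" using openin_subset[OF W(1)] top by simp
  have "\<not> q {y. x \<otimes>\<^bsub>G\<^esub> y \<in> W}" if x: "x \<in> S" for x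
  proof
    assume "q {y. x \<otimes>\<^bsub>G\<^esub> y \<in> W}"
    then have "q ({y. x \<otimes>\<^bsub>G\<^esub> y \<in> W} \<inter> S)" using q by (simp add: ultra_Int)
    \<comment> \<open>For such \<open>y\<close>, either \<open>y\<close> is in \<open>V x\<close>,
      or \<open>x y\<close> lies in \<open>W - U x\<close>, a member of \<open>J\<close>, so that
      \<open>y\<close> lies in a left translate of it. By left invariance the translate is in
      \<open>J\<close>; neither set is in \<open>q\<close>.\<close>
    moreover have "{y. x \<otimes>\<^bsub>G\<^esub> y \<in> W} \<inter> S \<subseteq> V x \<union> (\<lambda>a. inv\<^bsub>G\<^esub> x \<otimes>\<^bsub>G\<^esub> a) ` (W - U x)"
    proof
      fix y assume "y \<in> {y. x \<otimes>\<^bsub>G\<^esub> y \<in> W} \<inter> S"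
      then have y: "x \<otimes>\<^bsub>G\<^esub> y \<in> W" "y \<in> carrier G" and xG: "x \<in> carrier G" using SG x by auto
      have e: "y = inv\<^bsub>G\<^esub> x \<otimes>\<^bsub>G\<^esub> (x \<otimes>\<^bsub>G\<^esub> y)"
        using y xG by (simp add: m_assoc[symmetric])
      show "y \<in> V x \<union> (\<lambda>a. inv\<^bsub>G\<^esub> x \<otimes>\<^bsub>G\<^esub> a) ` (W - U x)"
      proof (cases "y \<in> V x")
        case False
        then have "x \<otimes>\<^bsub>G\<^esub> y \<in> W - U x" using y(1) e by (auto simp: U_def)
        then show ?thesis using e by blast
      qed simp
    qed
    ultimately have "q (V x) \<or> q ((\<lambda>a. inv\<^bsub>G\<^esub> x \<otimes>\<^bsub>G\<^esub> a) ` (W - U x))"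
      using ultra_mono[OF q(1)] ultra_Un[OF q(1)] by blast
    moreover have "inv\<^bsub>G\<^esub> x \<in> carrier G" using x SG by auto
    ultimately show False
      using V[OF x] openly_avoids_notin[OF q(1,3) shift[OF W(3)[OF x]]] by blast
  qed
  then have "{x. q {y. x \<otimes>\<^bsub>G\<^esub> y \<in> W}} \<inter> S = {} \<inter> S" by auto
  then have "\<not> conv (\<otimes>\<^bsub>G\<^esub>) p q W"
    unfolding conv_def using ultra_cong[OF p] ultra_empty[OF p(1)] by blast
  then show "\<exists>U. openin X U \<and> A \<subseteq> U \<and> \<not> conv (\<otimes>\<^bsub>G\<^esub>) p q U" using W B(2) by blast
qed

lemma not_chi_family_if_small:
  assumes "|S| <o chi X J"
  shows "\<not> chi_family X J S"
proof
  assume "chi_family X J S"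
  then have "chi X J \<le>o |S|" by (rule is_chi_chi(2))
  with assms show False using not_ordLess_ordLeq by metis
qed

text \<open>Failure of \<open>J\<close>-compactness supplies open neighbourhoods
  \<open>\<phi> A\<close> no finitely many of which cover \<open>S\<close>, hence an ultrafilter
  \<open>q\<close> outside all of them. Left multiples of \<open>q\<close> remain openly avoiding,
  and one of them is idempotent.\<close>

lemma ex_idempotent_openly_avoids:
  assumes LT: "left_topological_group G X" and JI: "set_ideal (carrier G) J"
    and LI: "left_invariant G J" and SS: "subsemigroup G S"
    and nc: "\<not> ideal_compact_in X J S" and chi: "\<not> chi_family X J S"
  shows "\<exists>e. ultra e \<and> e S \<and> conv (\<otimes>\<^bsub>G\<^esub>) e e = e \<and> openly_avoids X J e"
proof -
  interpret group G using LT by (simp add: left_topological_group_def)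
  have SG: "S \<subseteq> carrier G" using SS by (simp add: subsemigroup_def)
  interpret S: set_semigroup S "(\<otimes>\<^bsub>G\<^esub>)"
    using SS SG by unfold_locales (auto simp: subsemigroup_def subset_iff m_assoc)
  obtain \<phi> :: "'a set \<Rightarrow> 'a set" where \<phi>: "\<And>A. A \<in> J \<Longrightarrow> openin X (\<phi> A) \<and> A \<subseteq> \<phi> A"
    and no: "\<And>F. finite F \<Longrightarrow> F \<subseteq> J \<Longrightarrow> \<not> S \<subseteq> \<Union>(\<phi> ` F)"
  proof -
    have "S \<subseteq> topspace X" using SG LT by (simp add: left_topological_group_def)
    with nc have "\<exists>\<phi>. (\<forall>A\<in>J. openin X (\<phi> A) \<and> A \<subseteq> \<phi> A) \<and>
        (\<nexists>F. finite F \<and> F \<subseteq> J \<and> S \<subseteq> \<Union>(\<phi> ` F))"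
      unfolding ideal_compact_in_def by metis
    then show thesis using that by metis
  qed
  have "\<exists>q. ultra q \<and> q S \<and> (\<forall>U\<in>\<phi> ` J. \<not> q U)"
  proof (rule ex_ultra_avoiding)
    fix F assume "finite F" "F \<subseteq> \<phi> ` J"
    then obtain F' where "finite F'" "F' \<subseteq> J" "F = \<phi> ` F'" by (meson finite_subset_image)
    then show "\<not> S \<subseteq> \<Union>F" using no by blast
  qed
  then obtain q where q: "ultra q" "q S" "\<forall>U\<in>\<phi> ` J. \<not> q U" by blast
  then have qJ: "openly_avoids X J q" using \<phi> unfolding openly_avoids_def by blast
  show ?thesis
    using S.ex_idempotent_in_left_ideal[OF q(1,2)]
      openly_avoids_conv[OF LT JI LI SG chi _ _ q(1,2) qJ] by blast
qed


section \<open>Large families of sequences with disjoint finite products\<close>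

text \<open>By Zorn's lemma some disjoint family cannot absorb any further \<open>a\<close>. The
  guard \<open>H a \<noteq> {}\<close> is there because the empty set meets nothing.\<close>

lemma ex_maximal_disjoint_family:
  fixes Q :: "'s \<Rightarrow> bool" and H :: "'s \<Rightarrow> 'a set"
  shows "\<exists>\<A>. (\<forall>a\<in>\<A>. Q a) \<and> (\<forall>a\<in>\<A>. \<forall>b\<in>\<A>. a \<noteq> b \<longrightarrow> H a \<inter> H b = {}) \<and>
    (\<forall>a. Q a \<and> H a \<noteq> {} \<longrightarrow> H a \<inter> (\<Union>b\<in>\<A>. H b) \<noteq> {})"
proof -
  define \<F> where "\<F> = {\<A>. (\<forall>a\<in>\<A>. Q a) \<and> (\<forall>a\<in>\<A>. \<forall>b\<in>\<A>. a \<noteq> b \<longrightarrow> H a \<inter> H b = {})}"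
  have "\<exists>M\<in>\<F>. \<forall>Z\<in>\<F>. M \<subseteq> Z \<longrightarrow> Z = M"
  proof (rule subset_Zorn')
    fix C assume C: "subset.chain \<F> C"
    have "H a \<inter> H b = {}" if ab: "a \<in> A" "A \<in> C" "b \<in> B" "B \<in> C" "a \<noteq> b" for a b A B
    proof -
      have "A \<subseteq> B \<or> B \<subseteq> A" using C ab by (auto simp: subset.chain_def)
      then have "\<exists>Z\<in>C. a \<in> Z \<and> b \<in> Z" using ab by blast
      then show ?thesis using C ab(5) unfolding \<F>_def subset.chain_def by blast
    qed
    then have "\<forall>a\<in>\<Union>C. \<forall>b\<in>\<Union>C. a \<noteq> b \<longrightarrow> H a \<inter> H b = {}" by (meson UnionE)
    moreover have "\<forall>a\<in>\<Union>C. Q a" using C by (auto simp: \<F>_def subset.chain_def)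
    ultimately show "\<Union>C \<in> \<F>" by (simp add: \<F>_def)
  qed
  then obtain M where M: "M \<in> \<F>" and max: "\<And>Z. Z \<in> \<F> \<Longrightarrow> M \<subseteq> Z \<Longrightarrow> Z = M" by blast
  have "H a \<inter> (\<Union>b\<in>M. H b) \<noteq> {}" if a: "Q a" "H a \<noteq> {}" for a
  proof
    assume dis: "H a \<inter> (\<Union>b\<in>M. H b) = {}"
    then have "insert a M \<in> \<F>" using M a by (auto simp: \<F>_def)
    then have "insert a M = M" using max by blast
    then show False using dis a(2) by blast
  qed
  with M show ?thesis by (intro exI[of _ M]) (simp add: \<F>_def)
qed

theorem theorem1p7:
  fixes G :: "('a, 'b) monoid_scheme" and X :: "'a topology"
    and J :: "'a set set" and C S :: "'a set"
  assumes "left_topological_group G X" and "t1_space X"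
    and "set_ideal (carrier G) J" and "left_invariant G J" and "exhaustive X J"
    and "C \<in> J"
    and "subsemigroup G S" and "\<not> ideal_compact_in X J S"
    and "|S| <o chi X J"
  shows "\<exists>P. openin X P \<and> C \<subseteq> P \<and>
    (\<not> near_maximal X J \<longrightarrow> P \<in> positive_sets (carrier G) J) \<and>
    (\<forall>c. finite_coloring (S - P) c \<longrightarrow>
      (\<exists>\<A> :: (nat \<Rightarrow> 'a) set.
        (\<forall>a \<in> \<A>. injective_sequence_in (S - P) a) \<and>
        (\<forall>a \<in> \<A>. closed_discrete X (range a)) \<and>
        monochromatic (S - P) c (\<Union>a \<in> \<A>. FS G a) \<and>
        (\<forall>a \<in> \<A>. \<forall>b \<in> \<A>. a \<noteq> b \<longrightarrow> FS G a \<inter> FS G b = {}) \<and>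
        (\<Union>a \<in> \<A>. FS G a) \<in> positive_sets (carrier G) J \<and>
        (nicely_exhaustive G X S J \<longrightarrow> (\<forall>a \<in> \<A>. closed_discrete X (FS G a)))))"
proof -
  interpret group G using assms(1) by (simp add: left_topological_group_def)
  have top: "topspace X = carrier G" using assms(1) by (simp add: left_topological_group_def)
  have SG: "S \<subseteq> carrier G" using assms(7) by (simp add: subsemigroup_def)
  interpret S: set_semigroup S "(\<otimes>\<^bsub>G\<^esub>)"
    using assms(7) SG by unfold_locales (auto simp: subsemigroup_def subset_iff m_assoc)

  \<comment> \<open>The idempotent ultrafilter\<close>
  obtain e where e: "ultra e" "e S" "conv (\<otimes>\<^bsub>G\<^esub>) e e = e" and eJ: "openly_avoids X J e"
    using ex_idempotent_openly_avoids[OF assms(1,3,4,7,8) not_chi_family_if_small[OF assms(9)]]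
    by blast
  have notJ: "\<not> e A" if "A \<in> J" for A using openly_avoids_notin[OF e(1) eJ that] .
  have down: "B \<in> J" if "A \<in> J" "B \<subseteq> A" for A B
    using assms(3) that unfolding set_ideal_def by blast
  have eG: "e (topspace X)" using ultra_mono[OF e(1,2)] SG top by simp

  \<comment> \<open>The exhaustion\<close>
  obtain A :: "nat \<Rightarrow> 'a set" where A: "\<And>i. A i \<in> J" "\<And>i. openin X (A i)" "(\<Union>i. A i) = topspace X"
    "\<And>i. A i \<subseteq> A (Suc i)"
    and nice: "nicely_exhaustive G X S J \<Longrightarrow> \<forall>i. left_ideal_in G S (S - A i)"
  \<comment> \<open>A nice exhaustion is preferred when there is one, so that a single
    \<open>A\<close> controls both the sequences and their finite products.\<close>
  proof (cases "nicely_exhaustive G X S J")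
    case True
    then show thesis using that unfolding nicely_exhaustive_def top by metis
  next
    case False
    then show thesis using that assms(5) unfolding exhaustive_def by metis
  qed
  have Amono: "A i \<subseteq> A j" if "i \<le> j" for i j using lift_Suc_mono_le[of A, OF A(4) that] .

  \<comment> \<open>The open set \<open>P\<close>\<close>
  obtain P0 where P0: "openin X P0" "C \<subseteq> P0" "\<not> e P0"
    using eJ assms(6) unfolding openly_avoids_def by blast
  \<comment> \<open>If near-maximality fails, it fails for the trace of \<open>e\<close> on the
    space, which gives \<open>U\<close> in \<open>e\<close> whose closure has a
    \<open>J\<close>-positive complement. This open complement misses \<open>U\<close>, so it is
    outside \<open>e\<close>. In the near-maximal case \<open>{}\<close> will do.\<close>
  obtain P1 where P1: "openin X P1" "\<not> e P1" "\<not> near_maximal X J \<Longrightarrow> P1 \<notin> J"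
  proof (cases "near_maximal X J")
    case True
    then show thesis using that[of "{}"] ultra_empty[OF e(1)] by simp
  next
    case False
    then obtain U where U: "U \<subseteq> topspace X" "e U" "topspace X - X closure_of U \<notin> J"
      using ultrafilter_on_ultra[OF e(1) eG] unfolding near_maximal_def by blast
    have "\<not> e (topspace X - X closure_of U)"
      using ultra_mono[OF e(1) U(2) closure_of_subset[OF U(1)]] by (simp add: ultra_Diff[OF e(1)])
    then show thesis using U(3) by (intro that[of "topspace X - X closure_of U"]) (auto intro: openin_diff)
  qed
  define P where "P = P0 \<union> P1"
  have P: "openin X P" "C \<subseteq> P" "\<not> e P"
    using P0 P1 by (auto simp: P_def ultra_Un[OF e(1)])
  have Ppos: "P \<in> positive_sets (carrier G) J" if "\<not> near_maximal X J"
    using P1(3)[OF that] down[of P P1] openin_subset[OF P(1)] top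
    by (auto simp: positive_sets_def P_def)

  \<comment> \<open>Sequences for a given coloring\<close>
  have "\<exists>\<A> :: (nat \<Rightarrow> 'a) set.
        (\<forall>a \<in> \<A>. injective_sequence_in (S - P) a) \<and>
        (\<forall>a \<in> \<A>. closed_discrete X (range a)) \<and>
        monochromatic (S - P) c (\<Union>a \<in> \<A>. FS G a) \<and>
        (\<forall>a \<in> \<A>. \<forall>b \<in> \<A>. a \<noteq> b \<longrightarrow> FS G a \<inter> FS G b = {}) \<and>
        (\<Union>a \<in> \<A>. FS G a) \<in> positive_sets (carrier G) J \<and>
        (nicely_exhaustive G X S J \<longrightarrow> (\<forall>a \<in> \<A>. closed_discrete X (FS G a)))"
    if c: "finite_coloring (S - P) c" for c :: "'a \<Rightarrow> nat"
  proof -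
    have "e (S - P)" using e P(3) by (simp add: ultra_Diff)
    moreover have "S - P = (\<Union>k\<in>c ` (S - P). {x \<in> S - P. c x = k})" by blast
    ultimately have "e (\<Union>k\<in>c ` (S - P). {x \<in> S - P. c x = k})" by simp
    then obtain k where k: "e {x \<in> S - P. c x = k}"
      using ultra_finite_UN[OF e(1)] c unfolding finite_coloring_def by blast
    define M where "M = {x \<in> S - P. c x = k}"
    \<comment> \<open>Since \<open>A\<close> is increasing, \<open>a n \<notin> A n\<close> leaves
      only terms with index below \<open>i\<close> in \<open>A i\<close>; this is the local
      finiteness used for closed discreteness.\<close>
    define Q where "Q a \<longleftrightarrow> inj a \<and> (\<forall>n. a n \<notin> A n) \<and> FS G a \<subseteq> M" for a :: "nat \<Rightarrow> 'a"
    obtain \<A> where "(\<forall>a\<in>\<A>. Q a) \<and> (\<forall>a\<in>\<A>. \<forall>b\<in>\<A>. a \<noteq> b \<longrightarrow> FS G a \<inter> FS G b = {}) \<and>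
        (\<forall>a. Q a \<and> FS G a \<noteq> {} \<longrightarrow> FS G a \<inter> (\<Union>b\<in>\<A>. FS G b) \<noteq> {})"
      using ex_maximal_disjoint_family[of Q "FS G"] ..
    then have \<A>: "\<forall>a\<in>\<A>. Q a" "\<forall>a\<in>\<A>. \<forall>b\<in>\<A>. a \<noteq> b \<longrightarrow> FS G a \<inter> FS G b = {}"
      and max: "\<forall>a. Q a \<and> FS G a \<noteq> {} \<longrightarrow> FS G a \<inter> (\<Union>b\<in>\<A>. FS G b) \<noteq> {}"
      by simp_all
    define D where "D = (\<Union>b\<in>\<A>. FS G b)"
    have DM: "D \<subseteq> M" using \<A>(1) by (auto simp: D_def Q_def)
    have "D \<notin> J"
    proof
      assume "D \<in> J"
      then have "e (M - D)" using k notJ by (simp add: ultra_Diff[OF e(1)] M_def)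
      moreover have "e (- A n)" for n using notJ A(1) by (simp add: ultra_Compl[OF e(1)])
      \<comment> \<open>A point of the space lies in some \<open>A i\<close>, so its singleton is in
        \<open>J\<close>; any other singleton misses the space, which belongs to
        \<open>e\<close>.\<close>
      moreover have "\<not> e {x}" for x
      proof (cases "x \<in> topspace X")
        case True
        then obtain i where "x \<in> A i" using A(3) by blast
        then show ?thesis using notJ down[OF A(1)[of i]] by simp
      next
        case False
        then show ?thesis
          using eG ultra_Int[OF e(1), of "{x}" "topspace X"] ultra_empty[OF e(1)] by simp
      qed
      moreover have "M - D \<subseteq> S" by (auto simp: M_def)
      ultimately obtain a where a: "inj a" "\<forall>n. a n \<in> - A n"
        "\<And>n ns. sorted_wrt (<) (n # ns) \<Longrightarrow> foldl (\<otimes>\<^bsub>G\<^esub>) (a n) (map a ns) \<in> M - D"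
        using S.galvin_glazer[OF e, of "M - D" "\<lambda>n. - A n"] by blast
      have F: "FS G a \<subseteq> M - D" using a(3) unfolding FS_def by blast
      then have "Q a" using a by (auto simp: Q_def)
      moreover have "FS G a \<noteq> {}" using range_subset_FS[of a G] by blast
      ultimately show False using max F unfolding D_def by blast
    qed
    moreover have "D \<subseteq> carrier G" using DM SG by (auto simp: M_def)
    ultimately have Dpos: "D \<in> positive_sets (carrier G) J" by (simp add: positive_sets_def)
    have seq: "injective_sequence_in (S - P) a \<and> closed_discrete X (range a) \<and>
      (nicely_exhaustive G X S J \<longrightarrow> closed_discrete X (FS G a))" if "a \<in> \<A>" for a
    proof -
      have a: "inj a" "\<And>n. a n \<notin> A n" "FS G a \<subseteq> M" using \<A>(1) that by (auto simp: Q_def)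
      have F: "FS G a \<subseteq> S - P" using a(3) by (auto simp: M_def)
      then have R: "range a \<subseteq> S - P" using range_subset_FS[of a G] by blast
      have "range a \<inter> A i \<subseteq> a ` {..<i}" for i
      proof
        fix x assume "x \<in> range a \<inter> A i"
        then obtain n where n: "x = a n" "a n \<in> A i" by blast
        then have "n < i" using a(2)[of n] Amono[of i n] by (meson not_le subsetD)
        then show "x \<in> a ` {..<i}" using n by simp
      qed
      then have "finite (range a \<inter> A i)" for i by (meson finite_imageI finite_lessThan finite_subset)
      then have "closed_discrete X (range a)"
        using R SG top by (intro closed_discrete_if_locally_finite[where A = A] assms(2) A) auto
      moreover have "closed_discrete X (FS G a)" if "nicely_exhaustive G X S J"
      proof (rule closed_discrete_if_locally_finite[where A = A, OF assms(2) _ A(2,3)])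
        show "FS G a \<subseteq> topspace X" using F SG top by auto
        show "finite (FS G a \<inter> A i)" for i
          using R nice[OF that] Amono a(2) by (intro FS_finite_meet[where A = A and S = S] assms(7)) auto
      qed
      ultimately show ?thesis using a(1) R by (simp add: injective_sequence_in_def)
    qed
    have "monochromatic (S - P) c D" using DM unfolding monochromatic_def M_def by blast
    then show ?thesis
      using seq \<A>(2) Dpos unfolding D_def by (intro exI[of _ \<A>] conjI ballI impI) simp_all
  qed
  with P(1,2) Ppos show ?thesis by (intro exI[of _ P] conjI allI impI)
qed

end
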